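(* Let $N,K,n$ be nonnegative integers with $K\le N$ and $n\le N$, and let $X$ be a random variable with the hypergeometric distribution with parameters $(N,K,n)$. Then the probability-generating function $G_X(z)=E[z^X]=\sum_{k=0}^\infty \Pr(X=k)z^k$ of $X$ is given, for every $z\in\mathbb{C}$, by $$ G_X(z)=\begin{cases} \dfrac{(N-n)!\,(N-K)!}{N!\,(N-K-n)!}\;{}_2F_1(-n,-K;\,N-K-n+1;\,z) & \text{if } n\le N-K,\\[3mm] \dfrac{n!\,K!}{N!\,(n+K-N)!}\;z^{\,n+K-N}\;{}_2F_1(n-N,K-N;\,n+K-N+1;\,z) & \text{if } n\ge N-K+1. \end{cases} $$
   Context: Hypergeometric distribution: an urn contains $K$ white balls and $N-K$ black balls; $n$ balls are drawn at random without replacement, and $X$ is the number of white balls drawn. Thus $\Pr(X=k)=\binom{K}{k}\binom{N-K}{n-k}\big/\binom{N}{n}$, which is nonzero exactly for integers $k$ with $\max\{0,n+K-N\}\le k\le\min\{n,K\}$ (binomial coefficients with lower index negative or exceeding the upper index are $0$). Gauss hypergeometric function: ${}_2F_1(a,b;c;z)=\sum_{k=0}^\infty \frac{(a)_k(b)_k}{(c)_k}\frac{z^k}{k!}$, where $(a)_0=1$ and $(a)_k=a(a+1)\cdots(a+k-1)$ is the Pochhammer symbol. It is defined when $c$ is not zero or a negative integer. In the claim the first two arguments are nonpositive integers and the third is a positive integer, so each series is a finite sum (a polynomial in $z$). Convention: $z^0=1$ for all $z$. *)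

theory Defs
  imports
    "HOL-Probability.Probability"
    "HOL-Computational_Algebra.Formal_Power_Series"
begin

text \<open>
  The urn contains the balls \<open>0, \<dots>, N - 1\<close>, of which \<open>0, \<dots>, K - 1\<close> are white. Drawing \<open>n\<close> balls
  without replacement means picking an \<open>n\<close>-element subset uniformly at random. Only meaningful for
  \<open>K \<le> N\<close> and \<open>n \<le> N\<close>.
\<close>

definition hypergeometric_pmf :: "nat \<Rightarrow> nat \<Rightarrow> nat \<Rightarrow> nat pmf" where
  "hypergeometric_pmf N K n =
     map_pmf (\<lambda>S. card (S \<inter> {..<K})) (pmf_of_set {S. S \<subseteq> {..<N} \<and> card S = n})"

text \<open>
  The explicit condition \<open>k \<le> n\<close> is needed because \<open>n - k\<close> is truncated subtraction.
\<close>

lemma pmf_hypergeometric: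
  assumes "K \<le> N" "n \<le> N"
  shows "pmf (hypergeometric_pmf N K n) k =
    (if k \<le> n then real (K choose k) * real ((N - K) choose (n - k)) / real (N choose n) else 0)"
proof -
  let ?U = "{S. S \<subseteq> {..<N} \<and> card S = n}"
  let ?A = "{S \<in> ?U. card (S \<inter> {..<K}) = k}"
  have cardU: "card ?U = N choose n"
    using n_subsets[of "{..<N}" n] by simp
  have finU: "finite ?U"
    by (rule finite_subset[of _ "Pow {..<N}"]) auto
  have neU: "?U \<noteq> {}"
    using cardU assms by (metis card.empty zero_less_binomial less_irrefl)
  have cardA: "card ?A = (if k \<le> n then (K choose k) * ((N - K) choose (n - k)) else 0)"
  proof (cases "k \<le> n")
    case True
    let ?B = "{T. T \<subseteq> {..<K} \<and> card T = k}"
    let ?C = "{T. T \<subseteq> {K..<N} \<and> card T = n - k}"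
    have "bij_betw (\<lambda>S. (S \<inter> {..<K}, S \<inter> {K..<N})) ?A (?B \<times> ?C)"
    proof (rule bij_betw_byWitness[where f' = "\<lambda>(T, T'). T \<union> T'"])
      show "\<forall>S\<in>?A. (case (S \<inter> {..<K}, S \<inter> {K..<N}) of (T, T') \<Rightarrow> T \<union> T') = S"
        by force
      show "\<forall>p\<in>?B \<times> ?C. ((case p of (T, T') \<Rightarrow> T \<union> T') \<inter> {..<K},
              (case p of (T, T') \<Rightarrow> T \<union> T') \<inter> {K..<N}) = p"
        by force
      have "card (S \<inter> {K..<N}) = n - k" if "S \<in> ?A" for S
      proof -
        have fin: "finite S"
          using that finite_subset[of S "{..<N}"] by auto
        have "S = (S \<inter> {..<K}) \<union> (S \<inter> {K..<N})"
          using that by force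
        moreover have "card ((S \<inter> {..<K}) \<union> (S \<inter> {K..<N})) = card (S \<inter> {..<K}) + card (S \<inter> {K..<N})"
          by (rule card_Un_disjoint) (use fin in auto)
        ultimately have "card S = card (S \<inter> {..<K}) + card (S \<inter> {K..<N})"
          by metis
        moreover have "card S = n" "card (S \<inter> {..<K}) = k"
          using that by auto
        ultimately show ?thesis by linarith
      qed
      then show "(\<lambda>S. (S \<inter> {..<K}, S \<inter> {K..<N})) ` ?A \<subseteq> ?B \<times> ?C"
        by auto
      show "(\<lambda>(T, T'). T \<union> T') ` (?B \<times> ?C) \<subseteq> ?A"
      proof
        fix S assume "S \<in> (\<lambda>(T, T'). T \<union> T') ` (?B \<times> ?C)"
        then obtain T T' where S: "S = T \<union> T'"
          and T: "T \<subseteq> {..<K}" "card T = k" and T': "T' \<subseteq> {K..<N}" "card T' = n - k"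
          by auto
        have "finite T" "finite T'" "T \<inter> T' = {}"
          using T T' finite_subset[of T "{..<K}"] finite_subset[of T' "{K..<N}"] by force+
        then have "card S = n"
          using T T' True by (simp add: S card_Un_disjoint)
        moreover have "S \<inter> {..<K} = T"
          using T T' by (force simp: S)
        moreover have "S \<subseteq> {..<N}"
          using T T' assms by (force simp: S)
        ultimately show "S \<in> ?A"
          using T by simp
      qed
    qed
    then have "card ?A = card (?B \<times> ?C)"
      by (rule bij_betw_same_card)
    also have "\<dots> = (K choose k) * ((N - K) choose (n - k))"
      using n_subsets[of "{..<K}" k] n_subsets[of "{K..<N}" "n - k"]
      by (simp add: card_cartesian_product)
    finally show ?thesis using True by simp
  next
    case False
    have "?A = {}"
    proof -
      have "card (S \<inter> {..<K}) \<le> n" if "S \<in> ?U" for S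
        using that card_mono[of S "S \<inter> {..<K}"] finite_subset[of S "{..<N}"] by auto
      with False show ?thesis by auto
    qed
    with False show ?thesis by simp
  qed
  have "pmf (hypergeometric_pmf N K n) k = measure (pmf_of_set ?U) {S. card (S \<inter> {..<K}) = k}"
    unfolding hypergeometric_pmf_def pmf_map by (simp add: vimage_def)
  also have "\<dots> = real (card ?A) / real (card ?U)"
    using measure_pmf_of_set[OF neU finU] by (simp add: Int_def)
  finally show ?thesis
    using cardA cardU by simp
qed

definition prob_gen_fun :: "'a measure \<Rightarrow> ('a \<Rightarrow> nat) \<Rightarrow> complex \<Rightarrow> complex" where
  "prob_gen_fun M X z = (\<integral>\<omega>. z ^ X \<omega> \<partial>M)"

text \<open>
  The value is meaningful where the series converges and \<open>c\<close> is not a nonpositive integer.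
\<close>

definition hyp2F1 :: "complex \<Rightarrow> complex \<Rightarrow> complex \<Rightarrow> complex \<Rightarrow> complex" where
  "hyp2F1 a b c z = eval_fps (fps_hypergeo [a, b] [c] 1) z"

lemma hyp2F1_series:
  "hyp2F1 a b c z =
     (\<Sum>k. pochhammer a k * pochhammer b k / pochhammer c k * z ^ k / fact k)"
  by (simp add: hyp2F1_def eval_fps_def mult_ac)

end

theory Submission
  imports Defs
begin

text \<open>
  Both cases are instances of one polynomial identity: with \<open>d = N - K - n\<close>, \<open>a = n\<close>, \<open>b = K\<close> in the
  first case and \<open>d = n + K - N\<close>, \<open>a = N - n\<close>, \<open>b = N - K\<close> in the second, the unnormalised generating
  function is \<open>\<Sum>j. (d + a choose d + j) (b choose j) z\<^sup>j\<close>, up to the factor \<open>z\<^sup>d\<close> in the second case.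
\<close>

lemma pochhammer_minus_of_nat:
  "pochhammer (- of_nat a :: 'a :: field_char_0) k = (-1) ^ k * fact k * of_nat (a choose k)"
  by (simp add: binomial_gbinomial gbinomial_pochhammer flip: power_mult_distrib)

lemma pochhammer_of_nat_plus_1:
  "pochhammer (of_nat d + 1 :: 'a :: field_char_0) k = fact (d + k) / fact d"
  using pochhammer_product'[of "1 :: 'a" d k]
  by (simp add: add.commute field_simps flip: pochhammer_fact)

lemma hyp2F1_minus_nats:
  "hyp2F1 (- of_nat a) (- of_nat b) (of_nat d + 1) z =
     (\<Sum>j\<le>a. of_nat (a choose j) * of_nat (b choose j) * fact j * fact d / fact (d + j) * z ^ j)"
proof -
  have "hyp2F1 (- of_nat a) (- of_nat b) (of_nat d + 1) z =
     (\<Sum>j. of_nat (a choose j) * of_nat (b choose j) * fact j * fact d / fact (d + j) * z ^ j)"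
    \<comment> \<open>The two signs \<open>(-1) ^ k\<close> cancel, and one of the two factors
      \<open>fact k\<close> cancels the \<open>fact k\<close> of the series.\<close>
    unfolding hyp2F1_series pochhammer_minus_of_nat pochhammer_of_nat_plus_1
    by (intro suminf_cong) (simp add: field_simps flip: power_mult_distrib)
  also have "\<dots> = (\<Sum>j\<le>a. of_nat (a choose j) * of_nat (b choose j) * fact j * fact d / fact (d + j) * z ^ j)"
    by (rule suminf_finite) (auto simp: binomial_eq_0)
  finally show ?thesis .
qed

text \<open>The sums agree term by term: for \<open>j\<close> at most \<open>a\<close>, dividing
  \<open>d + a choose (d + j)\<close> by \<open>d + a choose d\<close> leaves
  \<open>a! d! / ((d + j)! (a - j)!)\<close>, which is \<open>a choose j\<close> times
  \<open>j! d! / (d + j)!\<close>.\<close>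

lemma sum_binomial_prod_eq_hyp2F1:
  "(\<Sum>j\<le>a. of_nat (d + a choose (d + j)) * of_nat (b choose j) * z ^ j) =
     of_nat (d + a choose d) * hyp2F1 (- of_nat a) (- of_nat b) (of_nat d + 1) z"
  unfolding hyp2F1_minus_nats sum_distrib_left
proof (rule sum.cong)
  fix j assume "j \<in> {..a}"
  then have "of_nat (d + a choose (d + j)) =
      (of_nat (d + a choose d) * of_nat (a choose j) * fact j * fact d / fact (d + j) :: complex)"
    by (simp add: binomial_fact)
  then show "of_nat (d + a choose (d + j)) * of_nat (b choose j) * z ^ j =
      of_nat (d + a choose d) *
        (of_nat (a choose j) * of_nat (b choose j) * fact j * fact d / fact (d + j) * z ^ j)"
    by simp
qed simp

text \<open>The Bochner integral of a non-integrable function is 0 by default, so integrability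
  certifies that \<open>prob_gen_fun\<close> is a genuine expectation.\<close>

lemma integrable_power_of_finite_pmf:
  fixes z :: complex
  assumes X: "X \<in> measurable M (count_space UNIV)"
    and distr: "distr M (count_space UNIV) X = measure_pmf p"
    and fin: "finite (set_pmf p)"
  shows "integrable M (\<lambda>\<omega>. z ^ X \<omega>)"
proof -
  have "integrable (distr M (count_space UNIV) X) (\<lambda>k. z ^ k)"
    unfolding distr by (rule integrable_measure_pmf_finite[OF fin])
  then show ?thesis
    by (rule integrable_distr[OF X])
qed

lemma prob_gen_fun_eq_sum_pmf:
  assumes X: "X \<in> measurable M (count_space UNIV)"
    and distr: "distr M (count_space UNIV) X = measure_pmf p"
    and A: "finite A" "set_pmf p \<subseteq> A"
  shows "prob_gen_fun M X z = (\<Sum>k\<in>A. complex_of_real (pmf p k) * z ^ k)"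
proof -
  have "prob_gen_fun M X z = (\<integral>k. z ^ k \<partial>distr M (count_space UNIV) X)"
    unfolding prob_gen_fun_def by (rule integral_distr[OF X, symmetric]) simp
  also have "\<dots> = (\<Sum>k\<in>A. pmf p k *\<^sub>R z ^ k)"
    unfolding distr by (rule integral_measure_pmf[OF A(1)]) (use A(2) in auto)
  finally show ?thesis
    by (simp add: scaleR_conv_of_real)
qed

lemma measure_eq_pmf_of_distr:
  assumes X: "X \<in> measurable M (count_space UNIV)"
    and distr: "distr M (count_space UNIV) X = measure_pmf p"
  shows "measure M {\<omega> \<in> space M. X \<omega> = k} = pmf p k"
proof -
  have "pmf p k = measure (distr M (count_space UNIV) X) {k}"
    by (simp add: distr measure_pmf_single)
  also have "\<dots> = measure M {\<omega> \<in> space M. X \<omega> = k}"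
    by (subst measure_distr[OF X]) (auto intro!: arg_cong[of _ _ "measure M"])
  finally show ?thesis by simp
qed

text \<open>This links the expectation in \<open>prob_gen_fun\<close> to the power series in the
  point probabilities; all terms outside the finite support vanish.\<close>

lemma sums_prob_gen_fun:
  assumes X: "X \<in> measurable M (count_space UNIV)"
    and distr: "distr M (count_space UNIV) X = measure_pmf p"
    and fin: "finite (set_pmf p)"
  shows "(\<lambda>k. complex_of_real (measure M {\<omega> \<in> space M. X \<omega> = k}) * z ^ k) sums prob_gen_fun M X z"
  unfolding measure_eq_pmf_of_distr[OF X distr] prob_gen_fun_eq_sum_pmf[OF X distr fin order_refl]
  by (rule sums_finite[OF fin]) (simp add: set_pmf_iff)

text \<open>The lower end comes from the factor \<open>(N - K) choose (n - k)\<close>, which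
  vanishes once more black balls are drawn than exist. Truncated subtraction turns it into the
  maximum of 0 and the integer \<open>n + K - N\<close>.\<close>

lemma set_pmf_hypergeometric_subset:
  assumes "K \<le> N" "n \<le> N"
  shows "set_pmf (hypergeometric_pmf N K n) \<subseteq> {n + K - N..n}"
proof
  fix k assume "k \<in> set_pmf (hypergeometric_pmf N K n)"
  then have "k \<le> n \<and> n - k \<le> N - K"
    using assms
    by (auto simp: set_pmf_iff pmf_hypergeometric binomial_eq_0_iff not_less split: if_splits)
  then show "k \<in> {n + K - N..n}"
    using assms by auto
qed

lemma prob_gen_fun_hypergeometric_le:
  assumes le: "K \<le> N" "n \<le> N" "n \<le> N - K"
    and X: "X \<in> measurable M (count_space UNIV)"
    and distr: "distr M (count_space UNIV) X = measure_pmf (hypergeometric_pmf N K n)"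
  shows "prob_gen_fun M X z =
    fact (N - n) * fact (N - K) / (fact N * fact (N - K - n)) *
    hyp2F1 (- of_nat n) (- of_nat K) (of_nat N - of_nat K - of_nat n + 1) z"
proof -
  define d where "d = N - K - n"
  have d: "N - K = d + n" "of_nat N - of_nat K - of_nat n = (of_nat d :: complex)"
    using le by (auto simp: d_def of_nat_diff)
  have "set_pmf (hypergeometric_pmf N K n) \<subseteq> {..n}"
    using set_pmf_hypergeometric_subset[OF le(1,2)] by auto
  then have "prob_gen_fun M X z =
      (\<Sum>k\<le>n. complex_of_real (pmf (hypergeometric_pmf N K n) k) * z ^ k)"
    by (intro prob_gen_fun_eq_sum_pmf[OF X distr]) auto
  also have "\<dots> = (\<Sum>k\<le>n. of_nat (d + n choose (d + k)) * of_nat (K choose k) * z ^ k) / of_nat (N choose n)"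
    unfolding sum_divide_distrib
  proof (rule sum.cong)
    fix k assume "k \<in> {..n}"
    \<comment> \<open>Reflecting the black-ball factor gives it the lower index \<open>d + k\<close>
      that \<open>sum_binomial_prod_eq_hyp2F1\<close> expects.\<close>
    moreover from this have "(d + n choose (n - k)) = (d + n choose (d + k))"
      using binomial_symmetric[of "d + k" "d + n"] by simp
    ultimately show "complex_of_real (pmf (hypergeometric_pmf N K n) k) * z ^ k =
        of_nat (d + n choose (d + k)) * of_nat (K choose k) * z ^ k / of_nat (N choose n)"
      using le by (simp add: pmf_hypergeometric d(1))
  qed simp
  also have "\<dots> = of_nat (d + n choose d) / of_nat (N choose n) *
      hyp2F1 (- of_nat n) (- of_nat K) (of_nat d + 1) z"
    by (simp add: sum_binomial_prod_eq_hyp2F1)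
  \<comment> \<open>Here \<open>d + n = N - K\<close>, and the factor \<open>n!\<close> in both
    denominators cancels.\<close>
  also have "of_nat (d + n choose d) / of_nat (N choose n) =
      (fact (N - n) * fact (N - K) / (fact N * fact d) :: complex)"
    using le by (simp add: binomial_fact d(1) mult.commute)
  finally show ?thesis
    by (simp add: d(2) d_def)
qed

lemma prob_gen_fun_hypergeometric_ge:
  assumes le: "K \<le> N" "n \<le> N" "N - K \<le> n"
    and X: "X \<in> measurable M (count_space UNIV)"
    and distr: "distr M (count_space UNIV) X = measure_pmf (hypergeometric_pmf N K n)"
  shows "prob_gen_fun M X z =
    fact n * fact K / (fact N * fact (n + K - N)) * z ^ (n + K - N) *
    hyp2F1 (of_nat n - of_nat N) (of_nat K - of_nat N)
      (of_nat n + of_nat K - of_nat N + 1) z"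
proof -
  define d a b where "d = n + K - N" and "a = N - n" and "b = N - K"
  have K: "K = d + a" and n: "n = d + b" and N: "N = d + a + b"
    using le by (auto simp: d_def a_def b_def)
  have "prob_gen_fun M X z =
      (\<Sum>k=d..d+b. complex_of_real (pmf (hypergeometric_pmf N K n) k) * z ^ k)"
    using set_pmf_hypergeometric_subset[OF le(1,2)]
    by (intro prob_gen_fun_eq_sum_pmf[OF X distr]) (auto simp: n K N)
  \<comment> \<open>Since the support starts at or above \<open>d\<close>, the shift
    \<open>k = d + j\<close> splits off \<open>z ^ d\<close>. Now the white-ball factor carries the
    offset \<open>d\<close>, and the black-ball factor is the one reflected to
    \<open>b choose j\<close>.\<close>
  also have "\<dots> = (\<Sum>j\<le>b. complex_of_real (pmf (hypergeometric_pmf N K n) (d + j)) * z ^ (d + j))"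
    using sum.shift_bounds_cl_nat_ivl[of _ 0 d b]
    by (simp add: atLeast0AtMost add.commute)
  also have "\<dots> = z ^ d / of_nat (N choose n) *
      (\<Sum>j\<le>b. of_nat (d + a choose (d + j)) * of_nat (b choose j) * z ^ j)"
    unfolding sum_distrib_left
  proof (rule sum.cong)
    fix j assume "j \<in> {..b}"
    moreover from this have "(b choose (b - j)) = (b choose j)"
      using binomial_symmetric[of j b] by simp
    ultimately show "complex_of_real (pmf (hypergeometric_pmf N K n) (d + j)) * z ^ (d + j) =
        z ^ d / of_nat (N choose n) * (of_nat (d + a choose (d + j)) * of_nat (b choose j) * z ^ j)"
      using le by (simp add: pmf_hypergeometric n K N power_add)
  qed simp
  \<comment> \<open>The ranges may be exchanged because the summand vanishes beyond \<open>a\<close>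
    through the first binomial and beyond \<open>b\<close> through the second.\<close>
  also have "(\<Sum>j\<le>b. of_nat (d + a choose (d + j)) * of_nat (b choose j) * z ^ j) =
      (\<Sum>j\<le>a. of_nat (d + a choose (d + j)) * of_nat (b choose j) * z ^ j)"
    by (rule sum.mono_neutral_cong) (auto simp: binomial_eq_0)
  also have "z ^ d / of_nat (N choose n) * \<dots> =
      of_nat (d + a choose d) / of_nat (N choose n) * z ^ d *
      hyp2F1 (- of_nat a) (- of_nat b) (of_nat d + 1) z"
    by (simp add: sum_binomial_prod_eq_hyp2F1)
  also have "of_nat (d + a choose d) / of_nat (N choose n) =
      (fact n * fact K / (fact N * fact d) :: complex)"
    by (simp add: binomial_fact n K N mult.commute)
  finally show ?thesis
    by (simp add: n K N)
qed

theorem theorem1p1: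
  fixes N K n :: nat and M :: "'a measure" and X :: "'a \<Rightarrow> nat" and z :: complex
  assumes "K \<le> N" and "n \<le> N"
    and "prob_space M"
    and "X \<in> measurable M (count_space UNIV)"
    and "distr M (count_space UNIV) X = measure_pmf (hypergeometric_pmf N K n)"
  shows "integrable M (\<lambda>\<omega>. z ^ X \<omega>) \<and>
    (\<lambda>k. complex_of_real (measure M {\<omega> \<in> space M. X \<omega> = k}) * z ^ k) sums prob_gen_fun M X z \<and>
    (n \<le> N - K \<longrightarrow>
      prob_gen_fun M X z =
        fact (N - n) * fact (N - K) / (fact N * fact (N - K - n)) *
        hyp2F1 (- of_nat n) (- of_nat K) (of_nat N - of_nat K - of_nat n + 1) z) \<and>
    (n \<ge> N - K + 1 \<longrightarrow>
      prob_gen_fun M X z =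
        fact n * fact K / (fact N * fact (n + K - N)) * z ^ (n + K - N) *
        hyp2F1 (of_nat n - of_nat N) (of_nat K - of_nat N)
          (of_nat n + of_nat K - of_nat N + 1) z)"
proof -
  have X: "X \<in> measurable M (count_space UNIV)"
    and distr: "distr M (count_space UNIV) X = measure_pmf (hypergeometric_pmf N K n)"
    by fact+
  have "finite (set_pmf (hypergeometric_pmf N K n))"
    using set_pmf_hypergeometric_subset[OF assms(1,2)] finite_subset by blast
  then show ?thesis
    using integrable_power_of_finite_pmf[OF X distr] sums_prob_gen_fun[OF X distr]
      prob_gen_fun_hypergeometric_le[OF assms(1,2) _ X distr]
      prob_gen_fun_hypergeometric_ge[OF assms(1,2) _ X distr]
    by simp
qed

end
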